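(* Let $f:\mathbb{R}\to\mathbb{R}$ be piecewise $C^1$ with $f(0)=0$. Suppose that every solution $\phi$ of $$\partial_t^2\phi-\Delta\phi+f(\phi)=0\quad\text{on }\mathbb{R}^{1+3}$$ with radially symmetric initial data in $H^1(\mathbb{R}^3)\times L^2(\mathbb{R}^3)$ is defined for all times $t\ge0$ and satisfies $$\lim_{t\to\infty}\|(\phi,\partial_t\phi)(t)\|_{H^1\times L^2(B(0,R))}=0\quad\text{for any }R>0 .$$ Then this equation has no nontrivial radially symmetric standing waves nor breathers.
   Context: Here $\phi=\phi(t,x)$ is real valued, $x\in\mathbb{R}^3$. Solutions are energy-space solutions: $\phi\in C([0,\infty);H^1(\mathbb{R}^3))\cap C^1([0,\infty);L^2(\mathbb{R}^3))$. A breather is a localized in space (i.e. $(\phi,\partial_t\phi)(t)\in H^1\times L^2$), time periodic solution. A standing wave is a time-independent solution in the energy space. Nontrivial means not identically zero. $B(0,R)\subset\mathbb{R}^3$ is the ball of radius $R$ centered at the origin. *)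

theory Defs
  imports "HOL-Analysis.Analysis"
begin

subsection \<open>Test functions\<close>

abbreviation dir_deriv :: "'a::euclidean_space \<Rightarrow> ('a \<Rightarrow> real) \<Rightarrow> 'a \<Rightarrow> real" where
  "dir_deriv v u \<equiv> (\<lambda>x. frechet_derivative u (at x) v)"

primrec Ck :: "nat \<Rightarrow> ('a::euclidean_space \<Rightarrow> real) \<Rightarrow> bool" where
  "Ck 0 u \<longleftrightarrow> continuous_on UNIV u"
| "Ck (Suc k) u \<longleftrightarrow> (\<forall>x. u differentiable (at x)) \<and> (\<forall>v. Ck k (dir_deriv v u))"

definition test_function :: "'a::euclidean_space set \<Rightarrow> ('a \<Rightarrow> real) \<Rightarrow> bool" where
  "test_function \<Omega> u \<longleftrightarrow>
     (\<forall>k. Ck k u) \<and> compact (closure {x. u x \<noteq> 0}) \<and> closure {x. u x \<noteq> 0} \<subseteq> \<Omega>"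

subsection \<open>The spaces \<open>L\<^sup>2\<close> and \<open>H\<^sup>1\<close>\<close>

text \<open>
  Elements of Lebesgue and Sobolev spaces are represented by Borel functions; two functions
  represent the same element if they agree almost everywhere.
\<close>

definition L2 :: "('a::euclidean_space \<Rightarrow> real) \<Rightarrow> bool" where
  "L2 u \<longleftrightarrow> u \<in> borel_measurable borel \<and> integrable lborel (\<lambda>x. (u x)\<^sup>2)"

definition L2_norm_on :: "'a::euclidean_space set \<Rightarrow> ('a \<Rightarrow> real) \<Rightarrow> real" where
  "L2_norm_on S u = sqrt (LINT x:S|lborel. (u x)\<^sup>2)"

definition weak_gradient :: "('a::euclidean_space \<Rightarrow> real) \<Rightarrow> ('a \<Rightarrow> 'a) \<Rightarrow> bool" where
  "weak_gradient u G \<longleftrightarrow>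
     (\<forall>e\<in>Basis. L2 (\<lambda>x. G x \<bullet> e) \<and>
       (\<forall>\<psi>. test_function UNIV \<psi> \<longrightarrow>
          (LINT x|lborel. u x * dir_deriv e \<psi> x) = - (LINT x|lborel. (G x \<bullet> e) * \<psi> x)))"

definition H1 :: "('a::euclidean_space \<Rightarrow> real) \<Rightarrow> bool" where
  "H1 u \<longleftrightarrow> L2 u \<and> (\<exists>G. weak_gradient u G)"

text \<open>
  The weak gradient of an \<open>H\<^sup>1\<close> function is unique up to a null set, so the choice below does
  not affect the norms.
\<close>

definition grad :: "('a::euclidean_space \<Rightarrow> real) \<Rightarrow> 'a \<Rightarrow> 'a" where
  "grad u = (SOME G. weak_gradient u G)"

definition H1_norm_on :: "'a::euclidean_space set \<Rightarrow> ('a \<Rightarrow> real) \<Rightarrow> real" where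
  "H1_norm_on S u = sqrt (LINT x:S|lborel. (u x)\<^sup>2 + (norm (grad u x))\<^sup>2)"

definition energy_norm_on ::
    "'a::euclidean_space set \<Rightarrow> ('a \<Rightarrow> real) \<Rightarrow> ('a \<Rightarrow> real) \<Rightarrow> real" where
  "energy_norm_on S u v = sqrt ((H1_norm_on S u)\<^sup>2 + (L2_norm_on S v)\<^sup>2)"

definition radial :: "('a::euclidean_space \<Rightarrow> real) \<Rightarrow> bool" where
  "radial u \<longleftrightarrow> (\<exists>g. AE x in lborel. u x = g (norm x))"

subsection \<open>Energy-space solutions\<close>

definition time_interval :: "ereal \<Rightarrow> real set" where
  "time_interval T = {t. 0 \<le> t \<and> ereal t < T}"

text \<open>
  \<open>\<phi> \<in> C([0,T); H\<^sup>1) \<inter> C\<^sup>1([0,T); L\<^sup>2)\<close>, where \<open>\<phi>'\<close> is the time derivative of \<open>\<phi>\<close> as an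
  \<open>L\<^sup>2\<close>-valued function (one-sided at \<open>t = 0\<close>). The joint measurability in \<open>(t, x)\<close> only
  restricts the choice of the representatives \<open>\<phi> t\<close>.
\<close>

definition energy_class ::
    "ereal \<Rightarrow> (real \<Rightarrow> 'a::euclidean_space \<Rightarrow> real) \<Rightarrow> (real \<Rightarrow> 'a \<Rightarrow> real) \<Rightarrow> bool" where
  "energy_class T \<phi> \<phi>' \<longleftrightarrow>
     set_borel_measurable borel (time_interval T \<times> UNIV) (\<lambda>(t, x). \<phi> t x) \<and>
     (\<forall>t\<in>time_interval T. H1 (\<phi> t) \<and> L2 (\<phi>' t) \<and>
        ((\<lambda>s. H1_norm_on UNIV (\<lambda>x. \<phi> s x - \<phi> t x)) \<longlongrightarrow> 0) (at t within time_interval T) \<and>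
        ((\<lambda>s. L2_norm_on UNIV (\<lambda>x. (\<phi> s x - \<phi> t x) / (s - t) - \<phi>' t x)) \<longlongrightarrow> 0)
           (at t within time_interval T) \<and>
        ((\<lambda>s. L2_norm_on UNIV (\<lambda>x. \<phi>' s x - \<phi>' t x)) \<longlongrightarrow> 0) (at t within time_interval T))"

definition wave_operator ::
    "(real \<times> 'a::euclidean_space \<Rightarrow> real) \<Rightarrow> real \<times> 'a \<Rightarrow> real" where
  "wave_operator \<psi> z =
     dir_deriv (1, 0) (dir_deriv (1, 0) \<psi>) z
     - (\<Sum>e\<in>Basis. dir_deriv (0, e) (dir_deriv (0, e) \<psi>) z)"

text \<open>
  \<open>\<partial>\<^sub>t\<^sup>2 \<phi> - \<Delta> \<phi> + f(\<phi>) = 0\<close> in the sense of distributions on \<open>(0,T) \<times> \<real>\<^sup>n\<close>. Local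
  integrability of \<open>f(\<phi>)\<close> is what makes the equation meaningful as an identity of distributions.
\<close>

definition solves_nlw ::
    "(real \<Rightarrow> real) \<Rightarrow> ereal \<Rightarrow> (real \<Rightarrow> 'a::euclidean_space \<Rightarrow> real) \<Rightarrow> bool" where
  "solves_nlw f T \<phi> \<longleftrightarrow>
     (let \<Omega> = {t. 0 < t \<and> ereal t < T} \<times> (UNIV :: 'a set) in
       (\<forall>K. compact K \<and> K \<subseteq> \<Omega> \<longrightarrow> set_integrable lborel K (\<lambda>(t, x). f (\<phi> t x))) \<and>
       (\<forall>\<psi>. test_function \<Omega> \<psi> \<longrightarrow>
          (LINT z:\<Omega>|lborel. \<phi> (fst z) (snd z) * wave_operator \<psi> z
                            + f (\<phi> (fst z) (snd z)) * \<psi> z) = 0))"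

definition energy_solution ::
    "(real \<Rightarrow> real) \<Rightarrow> ereal \<Rightarrow> (real \<Rightarrow> 'a::euclidean_space \<Rightarrow> real) \<Rightarrow> (real \<Rightarrow> 'a \<Rightarrow> real) \<Rightarrow> bool" where
  "energy_solution f T \<phi> \<phi>' \<longleftrightarrow> 0 < T \<and> energy_class T \<phi> \<phi>' \<and> solves_nlw f T \<phi>"

definition maximal_solution ::
    "(real \<Rightarrow> real) \<Rightarrow> ereal \<Rightarrow> (real \<Rightarrow> 'a::euclidean_space \<Rightarrow> real) \<Rightarrow> (real \<Rightarrow> 'a \<Rightarrow> real) \<Rightarrow> bool" where
  "maximal_solution f T \<phi> \<phi>' \<longleftrightarrow> energy_solution f T \<phi> \<phi>' \<and>
     \<not> (\<exists>S \<eta> \<eta>'. T < S \<and> energy_solution f S \<eta> \<eta>' \<and>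
           (\<forall>t\<in>time_interval T. AE x in lborel. \<eta> t x = \<phi> t x))"

subsection \<open>Standing waves and breathers\<close>

definition standing_wave :: "(real \<Rightarrow> real) \<Rightarrow> (real \<Rightarrow> 'a::euclidean_space \<Rightarrow> real) \<Rightarrow> bool" where
  "standing_wave f \<phi> \<longleftrightarrow> (\<exists>\<phi>'. energy_solution f \<infinity> \<phi> \<phi>') \<and>
     (\<forall>s\<ge>0. \<forall>t\<ge>0. AE x in lborel. \<phi> s x = \<phi> t x)"

definition breather :: "(real \<Rightarrow> real) \<Rightarrow> (real \<Rightarrow> 'a::euclidean_space \<Rightarrow> real) \<Rightarrow> bool" where
  "breather f \<phi> \<longleftrightarrow> (\<exists>\<phi>'. energy_solution f \<infinity> \<phi> \<phi>') \<and>
     (\<exists>P>0. \<forall>t\<ge>0. AE x in lborel. \<phi> (t + P) x = \<phi> t x)"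

definition radial_in_space :: "(real \<Rightarrow> 'a::euclidean_space \<Rightarrow> real) \<Rightarrow> bool" where
  "radial_in_space \<phi> \<longleftrightarrow> (\<forall>t\<ge>0. radial (\<phi> t))"

definition nontrivial :: "(real \<Rightarrow> 'a::euclidean_space \<Rightarrow> real) \<Rightarrow> bool" where
  "nontrivial \<phi> \<longleftrightarrow> \<not> (\<forall>t\<ge>0. AE x in lborel. \<phi> t x = 0)"

text \<open>
  Breakpoints may accumulate at infinity only; the library notion on a single interval allows
  finitely many of them and includes continuity.
\<close>

definition piecewise_C1 :: "(real \<Rightarrow> real) \<Rightarrow> bool" where
  "piecewise_C1 f \<longleftrightarrow> (\<forall>a b. f piecewise_C1_differentiable_on {a..b})"

end

(*
  A global energy solution is maximal, so the hypothesis applies to a radial breather as soon as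
  its initial velocity is radial; this holds because the velocity is an L^2 limit of radial
  difference quotients. The local decay, read along the times t + n P, then forces the solution
  to vanish on every ball. A standing wave is periodic with any period.
*)

theory Submission
  imports Defs
begin

lemma L2_cmult:
  assumes "L2 u"
  shows "L2 (\<lambda>x. c * u x)"
  using assms by (auto simp: L2_def power_mult_distrib)

lemma L2_add:
  assumes "L2 u" "L2 v"
  shows "L2 (\<lambda>x. u x + v x)"
proof -
  note [measurable] = assms[unfolded L2_def, THEN conjunct1]
  have "integrable lborel (\<lambda>x. (u x + v x)\<^sup>2)"
  proof (rule Bochner_Integration.integrable_bound)
    show "integrable lborel (\<lambda>x. 2 * (u x)\<^sup>2 + 2 * (v x)\<^sup>2)"
      using assms by (auto simp: L2_def)
    have "(u x + v x)\<^sup>2 \<le> 2 * (u x)\<^sup>2 + 2 * (v x)\<^sup>2" for x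
      \<comment> \<open>Right side minus left side is \<open>(u x - v x)\<^sup>2\<close>.\<close>
      using zero_le_power2[of "u x - v x"] by (simp add: power2_eq_square algebra_simps)
    then show "AE x in lborel. norm ((u x + v x)\<^sup>2) \<le> norm (2 * (u x)\<^sup>2 + 2 * (v x)\<^sup>2)"
      by simp
  qed simp
  then show ?thesis by (simp add: L2_def)
qed

lemma L2_diff:
  assumes "L2 u" "L2 v"
  shows "L2 (\<lambda>x. u x - v x)"
  using L2_add[OF assms(1) L2_cmult[OF assms(2), of "-1"]] by simp

text \<open>Periodicity is only an almost everywhere identity at each time; this carries it over to
  local norms. \<open>L2\<close> supplies the measurability behind the congruence of
  integrals.\<close>

lemma L2_norm_on_cong_AE:
  assumes "L2 u" "L2 v" "S \<in> sets borel" "AE x in lborel. u x = v x"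
  shows "L2_norm_on S u = L2_norm_on S v"
proof -
  note [measurable] = assms(1,2)[unfolded L2_def, THEN conjunct1] assms(3)
  have "(LINT x:S|lborel. (u x)\<^sup>2) = (LINT x:S|lborel. (v x)\<^sup>2)"
    unfolding set_lebesgue_integral_def
    by (rule integral_cong_AE) (use assms(4) in \<open>auto elim!: eventually_mono\<close>)
  then show ?thesis by (simp add: L2_norm_on_def)
qed

text \<open>\<open>grad u\<close> is a Hilbert choice; \<open>H1 u\<close> ensures that it picks a
  genuine weak gradient, whose components are square integrable and sum up to the squared norm. As
  the Bochner integral of a non-integrable function is 0 by default, bounding
  \<open>H1_norm_on\<close> from below relies on this.\<close>

lemma integrable_norm_grad_sq:
  assumes "H1 u"
  shows "integrable lborel (\<lambda>x. (norm (grad u x))\<^sup>2)"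
proof -
  have "weak_gradient u (grad u)"
    using assms unfolding H1_def grad_def by (simp add: someI_ex)
  then have "integrable lborel (\<lambda>x. (grad u x \<bullet> e)\<^sup>2)" if "e \<in> Basis" for e
    using that by (auto simp: weak_gradient_def L2_def)
  then have "integrable lborel (\<lambda>x. \<Sum>e\<in>Basis. (grad u x \<bullet> e)\<^sup>2)"
    by (intro Bochner_Integration.integrable_sum) auto
  moreover have "(norm (grad u x))\<^sup>2 = (\<Sum>e\<in>Basis. (grad u x \<bullet> e)\<^sup>2)" for x
    unfolding power2_norm_eq_inner
    by (subst euclidean_inner) (simp add: power2_eq_square)
  ultimately show ?thesis by simp
qed

text \<open>The gradient and \<open>v\<close> contribute only nonnegative terms. Monotonicity of the
  integral asks for both integrands to be integrable, which \<open>H1 u\<close> provides.\<close>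

lemma L2_norm_on_le_energy_norm_on:
  assumes "H1 u" "S \<in> sets borel"
  shows "L2_norm_on S u \<le> energy_norm_on S u v"
proof -
  have i: "integrable lborel (\<lambda>x. (u x)\<^sup>2)"
    using assms by (simp add: H1_def L2_def)
  have "(LINT x:S|lborel. (u x)\<^sup>2) \<le> (LINT x:S|lborel. (u x)\<^sup>2 + (norm (grad u x))\<^sup>2)"
    using assms(2) i Bochner_Integration.integrable_add[OF i integrable_norm_grad_sq[OF assms(1)]]
    unfolding set_lebesgue_integral_def
    by (intro integral_mono integrable_mult_indicator scaleR_left_mono) auto
  then have "L2_norm_on S u \<le> H1_norm_on S u"
    by (simp add: L2_norm_on_def H1_norm_on_def)
  also have "\<dots> \<le> energy_norm_on S u v"
    unfolding energy_norm_on_def by (rule real_le_rsqrt) simp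
  finally show ?thesis .
qed

text \<open>A nonnegative integrand with zero integral vanishes almost everywhere. The balls of
  radius \<open>Suc n\<close> exhaust the space, and countably many null sets have a null
  union.\<close>

lemma AE_zero_if_L2_norm_on_balls_zero:
  assumes "L2 u" and "\<And>R. R > 0 \<Longrightarrow> L2_norm_on (ball 0 R) u = 0"
  shows "AE x in lborel. u x = 0"
proof -
  have "AE x in lborel. x \<in> ball 0 (real (Suc n)) \<longrightarrow> u x = 0" for n
  proof -
    let ?B = "ball (0::'a) (real (Suc n))"
    have "(LINT x|lborel. indicator ?B x *\<^sub>R (u x)\<^sup>2) = 0"
      using assms(2)[of "real (Suc n)"] by (simp add: L2_norm_on_def set_lebesgue_integral_def)
    moreover have "integrable lborel (\<lambda>x. indicator ?B x *\<^sub>R (u x)\<^sup>2)"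
      using assms(1) by (intro integrable_mult_indicator) (auto simp: L2_def)
    ultimately have "AE x in lborel. indicator ?B x *\<^sub>R (u x)\<^sup>2 = 0"
      by (subst (asm) integral_nonneg_eq_0_iff_AE) auto
    then show ?thesis
      by eventually_elim (auto simp: indicator_def)
  qed
  then have "AE x in lborel. \<forall>n. x \<in> ball 0 (real (Suc n)) \<longrightarrow> u x = 0"
    by (rule AE_all_countable[THEN iffD2, rule_format])
  then show ?thesis
  proof eventually_elim
    case (elim x)
    obtain n where "norm x < real n" using reals_Archimedean2 by blast
    then have "x \<in> ball 0 (real (Suc n))" by simp
    then show ?case using elim by blast
  qed
qed

text \<open>Convergence in L2 yields almost everywhere convergence along a subsequence, and a
  pointwise limit of functions of \<open>norm x\<close> is again a function of
  \<open>norm x\<close>.\<close>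

lemma radial_L2_limit:
  assumes "\<And>n. L2 (u n)" "\<And>n. radial (u n)" "L2 v"
    and lim: "(\<lambda>n. L2_norm_on UNIV (\<lambda>x. u n x - v x)) \<longlonglongrightarrow> 0"
  shows "radial v"
proof -
  have "integrable lborel (\<lambda>x. (u n x - v x)\<^sup>2)" for n
    using L2_diff[OF assms(1,3)] by (simp add: L2_def)
  \<comment> \<open>The squared L2 norm of the difference is the L1 norm of its square, the form
    that the subsequence theorem for L1 takes.\<close>
  moreover have "(\<lambda>n. LINT x|lborel. norm ((u n x - v x)\<^sup>2)) \<longlonglongrightarrow> 0"
    using tendsto_power[OF lim, of 2]
    by (simp add: L2_norm_on_def set_lebesgue_integral_def)
  ultimately obtain r :: "nat \<Rightarrow> nat"
    where r: "AE x in lborel. (\<lambda>n. (u (r n) x - v x)\<^sup>2) \<longlonglongrightarrow> 0"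
    using tendsto_L1_AE_subseq[of lborel "\<lambda>n x. (u n x - v x)\<^sup>2"] by blast
  obtain g where "\<And>n. AE x in lborel. u n x = g n (norm x)"
    using assms(2) unfolding radial_def by metis
  then have g: "AE x in lborel. \<forall>n. u n x = g n (norm x)"
    by (simp add: AE_all_countable)
  \<comment> \<open>\<open>lim\<close> makes the limit profile total; its unspecified value at radii
    without convergence matters only on a null set of points.\<close>
  have "AE x in lborel. v x = lim (\<lambda>n. g (r n) (norm x))"
    using r g
  proof eventually_elim
    case (elim x)
    have "(\<lambda>n. \<bar>u (r n) x - v x\<bar>) \<longlonglongrightarrow> 0"
      using tendsto_real_sqrt[OF elim(1)] by simp
    then have "(\<lambda>n. u (r n) x) \<longlonglongrightarrow> v x"
      by (simp add: LIM_zero_iff tendsto_rabs_zero_iff)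
    then show ?case using elim(2) by (simp add: limI)
  qed
  then show ?thesis
    unfolding radial_def by (intro exI[of _ "\<lambda>s. lim (\<lambda>n. g (r n) s)"])
qed

lemma time_interval_infinity: "time_interval \<infinity> = {0..}"
  by (auto simp: time_interval_def)

text \<open>\<open>radial_in_space\<close> constrains only the solution itself, while the decay
  hypothesis of the theorem also asks for a radial initial velocity.\<close>

lemma radial_initial_velocity:
  assumes "energy_class \<infinity> \<phi> \<phi>'" "radial_in_space \<phi>"
  shows "radial (\<phi>' 0)"
proof -
  \<comment> \<open>The shift by one keeps every \<open>s n\<close> strictly positive: the filter
    \<open>at 0 within {0..}\<close> excludes 0 itself.\<close>
  define s where "s n = 1 / real (Suc n)" for n
  have spos: "s n > 0" for n by (simp add: s_def)
  have "s \<longlonglongrightarrow> 0"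
    unfolding s_def using LIMSEQ_Suc[OF lim_1_over_n] by simp
  then have s: "filterlim s (at 0 within {0..}) sequentially"
    using spos by (auto simp: filterlim_at less_imp_le less_imp_neq[symmetric] intro!: always_eventually)
  have L: "L2 (\<phi> t)" "L2 (\<phi>' t)" if "t \<ge> 0" for t
    using assms(1) that by (auto simp: energy_class_def time_interval_infinity H1_def)
  have "((\<lambda>s. L2_norm_on UNIV (\<lambda>x. (\<phi> s x - \<phi> 0 x) / (s - 0) - \<phi>' 0 x)) \<longlongrightarrow> 0)
      (at 0 within {0..})"
    using assms(1) unfolding energy_class_def time_interval_infinity by fastforce
  from filterlim_compose[OF this s]
  have "(\<lambda>n. L2_norm_on UNIV (\<lambda>x. (\<phi> (s n) x - \<phi> 0 x) / s n - \<phi>' 0 x)) \<longlonglongrightarrow> 0"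
    by simp
  moreover have "L2 (\<lambda>x. (\<phi> (s n) x - \<phi> 0 x) / s n)" for n
    using L2_cmult[OF L2_diff[OF L(1) L(1)], of "s n" 0 "1 / s n"] spos[of n] by simp
  moreover have "radial (\<lambda>x. (\<phi> (s n) x - \<phi> 0 x) / s n)" for n
  proof -
    obtain g h where "AE x in lborel. \<phi> (s n) x = g (norm x)" "AE x in lborel. \<phi> 0 x = h (norm x)"
      using assms(2) spos[of n] unfolding radial_in_space_def radial_def
      by (meson less_imp_le order_refl)
    then have "AE x in lborel. (\<phi> (s n) x - \<phi> 0 x) / s n = (g (norm x) - h (norm x)) / s n"
      by eventually_elim simp
    then show ?thesis
      unfolding radial_def by (intro exI[of _ "\<lambda>r. (g r - h r) / s n"])
  qed
  ultimately show ?thesis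
    using radial_L2_limit[of "\<lambda>n x. (\<phi> (s n) x - \<phi> 0 x) / s n" "\<phi>' 0"] L(2)[of 0] by simp
qed

text \<open>No extended real exceeds \<open>\<infinity>\<close>, so there is no longer interval to
  extend to.\<close>

lemma global_imp_maximal_solution:
  "energy_solution f \<infinity> \<phi> \<phi>' \<Longrightarrow> maximal_solution f \<infinity> \<phi> \<phi>'"
  by (simp add: maximal_solution_def)

lemma standing_wave_imp_breather: "standing_wave f \<phi> \<Longrightarrow> breather f \<phi>"
  unfolding standing_wave_def breather_def by (auto intro!: exI[of _ 1])

lemma periodic_locally_decaying_imp_trivial:
  assumes "energy_class \<infinity> \<phi> \<phi>'"
    and P: "P > 0" "\<And>t. t \<ge> 0 \<Longrightarrow> AE x in lborel. \<phi> (t + P) x = \<phi> t x"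
    and decay: "\<And>R. R > 0 \<Longrightarrow> ((\<lambda>t. energy_norm_on (ball 0 R) (\<phi> t) (\<phi>' t)) \<longlongrightarrow> 0) at_top"
  shows "\<not> nontrivial \<phi>"
proof -
  have H: "H1 (\<phi> t)" "L2 (\<phi> t)" if "t \<ge> 0" for t
    using assms(1) that by (auto simp: energy_class_def time_interval_infinity H1_def)
  have "AE x in lborel. \<phi> t x = 0" if t: "t \<ge> 0" for t
  proof (rule AE_zero_if_L2_norm_on_balls_zero)
    show "L2 (\<phi> t)" using H t by blast
    fix R :: real assume R: "R > 0"
    have nn: "t + real n * P \<ge> 0" for n using t P(1) by simp
    \<comment> \<open>One period per induction step; the a.e. identity applies since all the times
      \<open>t + real n * P\<close> are nonnegative.\<close>
    have per: "L2_norm_on (ball 0 R) (\<phi> (t + real n * P)) = L2_norm_on (ball 0 R) (\<phi> t)" for n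
    proof (induction n)
      case (Suc n)
      have *: "t + real (Suc n) * P = t + real n * P + P" by (simp add: algebra_simps)
      have "L2_norm_on (ball 0 R) (\<phi> (t + real (Suc n) * P))
          = L2_norm_on (ball 0 R) (\<phi> (t + real n * P))"
        using H(2)[OF nn[of n]] H(2)[OF nn[of "Suc n"]] P(2)[OF nn[of n]]
        unfolding * by (intro L2_norm_on_cong_AE) auto
      then show ?case using Suc by simp
    qed simp
    have "filterlim (\<lambda>n. real n * P) at_top sequentially"
      using filterlim_tendsto_pos_mult_at_top[OF tendsto_const P(1) filterlim_real_sequentially]
      by (simp add: mult.commute)
    then have "filterlim (\<lambda>n. t + real n * P) at_top sequentially"
      by (rule filterlim_tendsto_add_at_top[OF tendsto_const])
    from filterlim_compose[OF decay[OF R] this]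
    have "(\<lambda>n. energy_norm_on (ball 0 R) (\<phi> (t + real n * P)) (\<phi>' (t + real n * P))) \<longlonglongrightarrow> 0" .
    moreover have "L2_norm_on (ball 0 R) (\<phi> t)
        \<le> energy_norm_on (ball 0 R) (\<phi> (t + real n * P)) (\<phi>' (t + real n * P))" for n
      using L2_norm_on_le_energy_norm_on[OF H(1)[OF nn[of n]], of "ball 0 R"] per[of n] by simp
    \<comment> \<open>A constant that lies below every term of a null sequence is at most 0.\<close>
    ultimately have "L2_norm_on (ball 0 R) (\<phi> t) \<le> 0"
      by (intro LIMSEQ_le_const) auto
    moreover have "L2_norm_on (ball 0 R) (\<phi> t) \<ge> 0"
      by (auto simp: L2_norm_on_def set_lebesgue_integral_def intro!: Bochner_Integration.integral_nonneg)
    ultimately show "L2_norm_on (ball 0 R) (\<phi> t) = 0" by simp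
  qed
  then show ?thesis by (simp add: nontrivial_def)
qed

theorem corollary3p3:
  fixes f :: "real \<Rightarrow> real"
  assumes "piecewise_C1 f" and "f 0 = 0"
    and "\<And>T (\<phi> :: real \<Rightarrow> real ^ 3 \<Rightarrow> real) \<phi>'.
           maximal_solution f T \<phi> \<phi>' \<Longrightarrow> radial (\<phi> 0) \<Longrightarrow> radial (\<phi>' 0) \<Longrightarrow>
           T = \<infinity> \<and>
           (\<forall>R>0. ((\<lambda>t. energy_norm_on (ball 0 R) (\<phi> t) (\<phi>' t)) \<longlongrightarrow> 0) at_top)"
  shows "\<not> (\<exists>\<phi> :: real \<Rightarrow> real ^ 3 \<Rightarrow> real.
              standing_wave f \<phi> \<and> radial_in_space \<phi> \<and> nontrivial \<phi>) \<and>
         \<not> (\<exists>\<phi> :: real \<Rightarrow> real ^ 3 \<Rightarrow> real.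
              breather f \<phi> \<and> radial_in_space \<phi> \<and> nontrivial \<phi>)"
proof -
  \<comment> \<open>Breathers suffice, since every standing wave is one.\<close>
  have "\<not> nontrivial \<phi>" if b: "breather f \<phi>" and r: "radial_in_space \<phi>"
    for \<phi> :: "real \<Rightarrow> real ^ 3 \<Rightarrow> real"
  proof -
    obtain \<phi>' P where sol: "energy_solution f \<infinity> \<phi> \<phi>'"
      and P: "P > 0" "\<And>t. t \<ge> 0 \<Longrightarrow> AE x in lborel. \<phi> (t + P) x = \<phi> t x"
      using b unfolding breather_def by blast
    have cls: "energy_class \<infinity> \<phi> \<phi>'" using sol by (simp add: energy_solution_def)
    have "radial (\<phi> 0)" using r by (simp add: radial_in_space_def)
    from assms(3)[OF global_imp_maximal_solution[OF sol] this radial_initial_velocity[OF cls r]]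
    show ?thesis
      using periodic_locally_decaying_imp_trivial[OF cls P] by blast
  qed
  then show ?thesis using standing_wave_imp_breather by blast
qed

end
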